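(* Let $m\ge1$ and $A\in GL(m,\mathbb{R})$. Then exactly one of the following three alternatives holds: 1. $\langle Ax,x\rangle>0$ for all $x\in\mathbb{R}^m\setminus\{0\}$; this condition is equivalent to each of the following: each member of $\mathcal{O}(A)$ is an FS-matrix; each member of $\mathcal{O}(A)$ is a Q-matrix; each member of $\mathcal{O}(A)$ is a P-matrix. 2. $\langle Ax,x\rangle\le 0$ for all $x\in\mathbb{R}^m$; in this case no matrix in $\mathcal{O}(A)$ has the FS-property. 3. There are non-zero $x,y\in\mathbb{R}^m$ with $\langle Ax,x\rangle>0$ and $\langle Ay,y\rangle\le 0$; in this case $\mathcal{O}(A)$ contains a matrix which is not an FS-matrix and also contains a Q-matrix.
   Context: $\mathbb{R}^m$ is the space of column vectors with the standard scalar product $\langle\cdot,\cdot\rangle$, and $\mathbb{R}^m_+$ is the non-negative orthant. $GL(m,\mathbb{R})$ is the group of invertible real $m\times m$ matrices. The congruence orbit of $A\in\mathbb{R}^{m\times m}$ is $\mathcal{O}(A)=\{L^\top AL: L\in GL(m,\mathbb{R})\}$. For $B\in\mathbb{R}^{m\times m}$ and $q\in\mathbb{R}^m$, the problem $\mathrm{LCP}(B,q)$ is to find $x\in\mathbb{R}^m_+$ with $Bx+q\in\mathbb{R}^m_+$ and $\langle x,Bx+q\rangle=0$. $B$ is a Q-matrix if $\mathrm{LCP}(B,q)$ has a solution for all $q\in\mathbb{R}^m$; a P-matrix if $\mathrm{LCP}(B,q)$ has a unique solution for all $q\in\mathbb{R}^m$; an FS-matrix (i.e. has the FS-property) if $(B\mathbb{R}^m_++q)\cap\mathbb{R}^m_+\neq\varnothing$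 for all $q\in\mathbb{R}^m$. *)

theory Defs
  imports "HOL-Analysis.Analysis"
begin

definition nonneg_orthant :: "(real ^ 'm) set" where
  "nonneg_orthant = {x. \<forall>i. 0 \<le> x $ i}"

definition congruence_orbit :: "real ^ 'm ^ 'm \<Rightarrow> (real ^ 'm ^ 'm) set" where
  "congruence_orbit A = {transpose L ** A ** L | L. invertible L}"

definition lcp_solution :: "real ^ 'm ^ 'm \<Rightarrow> real ^ 'm \<Rightarrow> real ^ 'm \<Rightarrow> bool" where
  "lcp_solution B q x \<longleftrightarrow>
     x \<in> nonneg_orthant \<and> B *v x + q \<in> nonneg_orthant \<and> x \<bullet> (B *v x + q) = 0"

definition Q_matrix :: "real ^ 'm ^ 'm \<Rightarrow> bool" where
  "Q_matrix B \<longleftrightarrow> (\<forall>q. \<exists>x. lcp_solution B q x)"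

(* Unique solvability of every LCP, rather than positivity of the principal minors. *)
definition P_matrix :: "real ^ 'm ^ 'm \<Rightarrow> bool" where
  "P_matrix B \<longleftrightarrow> (\<forall>q. \<exists>!x. lcp_solution B q x)"

definition FS_matrix :: "real ^ 'm ^ 'm \<Rightarrow> bool" where
  "FS_matrix B \<longleftrightarrow>
     (\<forall>q. ((\<lambda>x. B *v x + q) ` nonneg_orthant) \<inter> nonneg_orthant \<noteq> {})"

definition form_positive :: "real ^ 'm ^ 'm \<Rightarrow> bool" where
  "form_positive A \<longleftrightarrow> (\<forall>x. x \<noteq> 0 \<longrightarrow> (A *v x) \<bullet> x > 0)"

definition form_nonpositive :: "real ^ 'm ^ 'm \<Rightarrow> bool" where
  "form_nonpositive A \<longleftrightarrow> (\<forall>x. (A *v x) \<bullet> x \<le> 0)"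

definition form_mixed :: "real ^ 'm ^ 'm \<Rightarrow> bool" where
  "form_mixed A \<longleftrightarrow>
     (\<exists>x y. x \<noteq> 0 \<and> y \<noteq> 0 \<and> (A *v x) \<bullet> x > 0 \<and> (A *v y) \<bullet> y \<le> 0)"

end

theory Submission
  imports Defs
begin

text \<open>
  The mixed case rests on choosing the columns of \<open>L\<close> well, since the entries of
  \<open>L\<^sup>T A L\<close> are the values of the bilinear form of \<open>A\<close> on pairs of columns.
  If \<open>\<langle>Ax, x\<rangle> > 0\<close>, a basis of small perturbations of \<open>x\<close> gives a matrix
  with positive entries. If \<open>\<langle>Ay, y\<rangle> \<le> 0\<close> with \<open>y \<noteq> 0\<close>, extend
  \<open>y\<close> to a basis and flip signs of the other vectors to get a matrix with a nonpositive
  row, which cannot have the FS-property. Matrices with positive entries and matrices with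
  positive definite form are both strictly copositive, and a strictly copositive matrix is a
  Q-matrix: by Brouwer's theorem the complementarity problem has a solution on a large cube, and
  strict copositivity keeps it away from the outer faces.
\<close>

section \<open>Bilinear forms under congruence\<close>

lemma invertible_iff_ker:
  fixes L :: "real ^ 'm ^ 'm"
  shows "invertible L \<longleftrightarrow> (\<forall>v. L *v v = 0 \<longrightarrow> v = 0)"
  by (simp add: invertible_left_inverse matrix_left_invertible_ker)

lemma congruence_form:
  fixes A L :: "real ^ 'm ^ 'm"
  shows "((transpose L ** A ** L) *v x) \<bullet> y = (A *v (L *v x)) \<bullet> (L *v y)"
proof -
  have "((transpose L ** A ** L) *v x) \<bullet> y = (transpose L *v (A *v (L *v x))) \<bullet> y"
    by (simp add: matrix_vector_mul_assoc matrix_mul_assoc)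
  then show ?thesis
    by (simp add: transpose_matrix_vector dot_lmul_matrix)
qed

text \<open>Combined with \<open>congruence_form\<close>, this evaluates entry \<open>i\<close>,
  \<open>j\<close> of a congruent matrix on columns \<open>j\<close> and \<open>i\<close> of
  \<open>L\<close>.\<close>

lemma matrix_entry_form:
  fixes B :: "real ^ 'm ^ 'm"
  shows "B $ i $ j = (B *v axis j 1) \<bullet> axis i 1"
  by (simp add: inner_axis matrix_vector_mult_basis column_def)

lemma congruence_orbit_refl:
  fixes A :: "real ^ 'm ^ 'm"
  shows "A \<in> congruence_orbit A"
  unfolding congruence_orbit_def
  by (force intro: exI[of _ "mat 1"] simp: transpose_mat invertible_def)

lemma form_positive_congruence:
  fixes A :: "real ^ 'm ^ 'm"
  assumes "form_positive A" "B \<in> congruence_orbit A"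
  shows "form_positive B"
proof -
  obtain L where "invertible L" "B = transpose L ** A ** L"
    using assms by (auto simp: congruence_orbit_def)
  with assms(1) show ?thesis
    by (auto simp: form_positive_def congruence_form invertible_iff_ker)
qed

lemma form_nonpositive_congruence:
  fixes A :: "real ^ 'm ^ 'm"
  assumes "form_nonpositive A" "B \<in> congruence_orbit A"
  shows "form_nonpositive B"
  using assms by (auto simp: congruence_orbit_def form_nonpositive_def congruence_form)

section \<open>Matrix classes and solvability for strictly copositive matrices\<close>

lemma Q_imp_FS:
  fixes B :: "real ^ 'm ^ 'm"
  assumes "Q_matrix B"
  shows "FS_matrix B"
  using assms unfolding Q_matrix_def FS_matrix_def lcp_solution_def by blast

lemma P_imp_Q:
  fixes B :: "real ^ 'm ^ 'm"
  assumes "P_matrix B"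
  shows "Q_matrix B"
  using assms unfolding Q_matrix_def P_matrix_def by blast

lemma box_complementarity:
  fixes f :: "real ^ 'm \<Rightarrow> real ^ 'm"
  assumes "continuous_on UNIV f" "R > 0"
  obtains x where "\<And>i. 0 \<le> x $ i" "\<And>i. x $ i \<le> R"
    "\<And>i. x $ i < R \<Longrightarrow> 0 \<le> f x $ i" "\<And>i. x $ i > 0 \<Longrightarrow> f x $ i \<le> 0"
proof -
  define K :: "(real ^ 'm) set" where "K = cbox 0 (\<chi> i. R)"
  \<comment> \<open>\<open>g\<close> projects \<open>x - f x\<close> onto the cube, so its fixed
    points solve the variational inequality of \<open>f\<close> there; the four claims are read off
    coordinatewise.\<close>
  define g where "g = (\<lambda>x. \<chi> i. min R (max 0 (x $ i - f x $ i)))"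
  have K: "x \<in> K \<longleftrightarrow> (\<forall>i. 0 \<le> x $ i \<and> x $ i \<le> R)" for x
    by (simp add: K_def mem_box_cart)
  have "continuous_on K g"
    unfolding g_def
    by (intro continuous_intros continuous_on_subset[OF assms(1)]) auto
  moreover have "g \<in> K \<rightarrow> K"
    using \<open>R > 0\<close> by (auto simp: K g_def)
  moreover have "K \<noteq> {}"
    using \<open>R > 0\<close> K[of 0] by auto
  ultimately obtain x where "x \<in> K" "g x = x"
    using brouwer[of K g] by (auto simp: K_def)
  then have x: "min R (max 0 (x $ i - f x $ i)) = x $ i" for i
    by (metis g_def vec_lambda_beta)
  show ?thesis
  proof
    fix i
    show "0 \<le> x $ i" "x $ i \<le> R"
      using \<open>x \<in> K\<close> by (auto simp: K)
    show "0 \<le> f x $ i" if "x $ i < R"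
      using x[of i] that by (auto simp: min_def max_def split: if_splits)
    show "f x $ i \<le> 0" if "x $ i > 0"
      using x[of i] that by (auto simp: min_def max_def split: if_splits)
  qed
qed

text \<open>By compactness the form attains a positive minimum \<open>c\<close> on the unit vectors
  of the orthant; homogeneity of degree two does the rest.\<close>

lemma strictly_copositive_bound:
  fixes B :: "real ^ 'm ^ 'm"
  assumes "\<And>x. x \<in> nonneg_orthant \<Longrightarrow> x \<noteq> 0 \<Longrightarrow> (B *v x) \<bullet> x > 0"
  obtains c where "c > 0" "\<And>x. x \<in> nonneg_orthant \<Longrightarrow> c * (norm x)\<^sup>2 \<le> (B *v x) \<bullet> x"
proof -
  define S :: "(real ^ 'm) set" where "S = sphere 0 1 \<inter> nonneg_orthant"
  have "closed (nonneg_orthant :: (real ^ 'm) set)"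
    unfolding nonneg_orthant_def
    by (intro closed_Collect_all closed_Collect_le continuous_intros)
  then have "compact S"
    unfolding S_def by (intro compact_Int_closed compact_sphere)
  \<comment> \<open>Any axis vector shows that \<open>S\<close> is nonempty, so the minimum is
    attained.\<close>
  moreover have "axis undefined 1 \<in> S"
    by (auto simp: S_def nonneg_orthant_def axis_def[of _ "1::real"] norm_axis_1[unfolded axis_def])
  moreover have "continuous_on S (\<lambda>x. (B *v x) \<bullet> x)"
    by (intro continuous_intros linear_continuous_on matrix_vector_mul_bounded_linear)
  ultimately obtain z where z: "z \<in> S" "\<And>x. x \<in> S \<Longrightarrow> (B *v z) \<bullet> z \<le> (B *v x) \<bullet> x"
    using continuous_attains_inf[of S "\<lambda>x. (B *v x) \<bullet> x"] by blast
  show ?thesis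
  proof
    show "(B *v z) \<bullet> z > 0"
      using z(1) by (intro assms) (auto simp: S_def)
    fix x :: "real ^ 'm"
    assume x: "x \<in> nonneg_orthant"
    show "(B *v z) \<bullet> z * (norm x)\<^sup>2 \<le> (B *v x) \<bullet> x"
    proof (cases "x = 0")
      case False
      then have "x /\<^sub>R norm x \<in> S"
        using x by (auto simp: S_def nonneg_orthant_def)
      from z(2)[OF this] have "(B *v z) \<bullet> z \<le> (B *v x) \<bullet> x / (norm x)\<^sup>2"
        by (simp add: matrix_vector_mult_scaleR power2_eq_square divide_simps)
      then show ?thesis
        using False by (simp add: pos_le_divide_eq)
    qed simp
  qed
qed

lemma strictly_copositive_imp_Q:
  fixes B :: "real ^ 'm ^ 'm"
  assumes "\<And>x. x \<in> nonneg_orthant \<Longrightarrow> x \<noteq> 0 \<Longrightarrow> (B *v x) \<bullet> x > 0"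
  shows "Q_matrix B"
  unfolding Q_matrix_def
proof
  fix q :: "real ^ 'm"
  obtain c where c: "c > 0" "\<And>x. x \<in> nonneg_orthant \<Longrightarrow> c * (norm x)\<^sup>2 \<le> (B *v x) \<bullet> x"
    using strictly_copositive_bound[OF assms] by blast
  \<comment> \<open>Every solution on the cube will satisfy \<open>norm x \<le> norm q / c\<close>;
    the extra 1 makes all its coordinates strictly less than \<open>R\<close>, so no upper face is
    active.\<close>
  define R where "R = norm q / c + 1"
  have "R > 0"
    using c(1) by (simp add: R_def add_nonneg_pos)
  moreover have "continuous_on UNIV (\<lambda>x. B *v x + q)"
    by (intro continuous_intros linear_continuous_on matrix_vector_mul_bounded_linear)
  ultimately obtain x where x: "\<And>i. 0 \<le> x $ i" "\<And>i. x $ i \<le> R"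
      "\<And>i. x $ i < R \<Longrightarrow> 0 \<le> (B *v x + q) $ i" "\<And>i. x $ i > 0 \<Longrightarrow> (B *v x + q) $ i \<le> 0"
    using box_complementarity by blast
  have "x \<in> nonneg_orthant"
    using x(1) by (simp add: nonneg_orthant_def)
  have xF: "x $ i * (B *v x + q) $ i \<le> 0" for i
    using x(1)[of i] x(4)[of i] by (cases "x $ i = 0") (auto intro: mult_nonneg_nonpos)
  then have "x \<bullet> (B *v x + q) \<le> 0"
    unfolding inner_vec_def inner_real_def by (intro sum_nonpos)
  then have "c * (norm x)\<^sup>2 \<le> - (x \<bullet> q)"
    using c(2)[OF \<open>x \<in> nonneg_orthant\<close>] by (simp add: inner_add_right inner_commute)
  also have "\<dots> \<le> norm x * norm q"
    using norm_cauchy_schwarz[of x "- q"] by simp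
  finally have "norm x * (c * norm x) \<le> norm x * norm q"
    by (simp add: power2_eq_square algebra_simps)
  then have "norm x \<le> norm q / c"
    using c(1) by (cases "x = 0") (auto simp: pos_le_divide_eq mult.commute)
  then have "x $ i < R" for i
    using component_le_norm_cart[of x i] by (simp add: R_def)
  then have F: "0 \<le> (B *v x + q) $ i" for i
    using x(3) by blast
  \<comment> \<open>Each product was nonpositive on the cube and is now nonnegative, as both factors
    are.\<close>
  have "x $ i * (B *v x + q) $ i = 0" for i
    using xF[of i] mult_nonneg_nonneg[OF x(1) F, of i i] by (rule antisym)
  then have "x \<bullet> (B *v x + q) = 0"
    unfolding inner_vec_def inner_real_def by (intro sum.neutral ballI)
  then show "\<exists>x. lcp_solution B q x"
    using F \<open>x \<in> nonneg_orthant\<close> by (auto simp: lcp_solution_def nonneg_orthant_def)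
qed

section \<open>Unique solvability for positive definite forms\<close>

lemma nonneg_orthant_inner:
  assumes "x \<in> nonneg_orthant" "y \<in> nonneg_orthant"
  shows "0 \<le> x \<bullet> y"
  using assms by (auto simp: inner_vec_def nonneg_orthant_def intro!: sum_nonneg)

lemma form_positive_imp_P:
  fixes B :: "real ^ 'm ^ 'm"
  assumes "form_positive B"
  shows "P_matrix B"
proof -
  have Q: "Q_matrix B"
    using assms by (intro strictly_copositive_imp_Q) (auto simp: form_positive_def)
  have "x = y" if "lcp_solution B q x" "lcp_solution B q y" for q x y
  proof -
    have "0 \<le> x \<bullet> (B *v y + q)" "0 \<le> y \<bullet> (B *v x + q)"
      using that by (auto simp: lcp_solution_def intro: nonneg_orthant_inner)
    \<comment> \<open>By complementarity of both solutions the left side expands to minus the sum of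
      the two cross products just bounded.\<close>
    then have "(B *v (x - y)) \<bullet> (x - y) \<le> 0"
      using that
      by (simp add: lcp_solution_def matrix_vector_mult_diff_distrib algebra_simps inner_commute)
    then show ?thesis
      using assms unfolding form_positive_def by (metis eq_iff_diff_eq_0 not_less)
  qed
  with Q show ?thesis
    unfolding P_matrix_def Q_matrix_def by blast
qed

section \<open>Obstructions to the FS-property\<close>

lemma FS_imp_positive_image:
  fixes B :: "real ^ 'm ^ 'm"
  assumes "FS_matrix B"
  obtains x where "\<And>i. 0 \<le> x $ i" "\<And>i. 1 \<le> (B *v x) $ i"
proof -
  \<comment> \<open>The choice of \<open>q\<close> with all coordinates -1 forces
    \<open>B *v x\<close> to be strictly positive.\<close>
  have "((\<lambda>x. B *v x + (\<chi> i. - 1)) ` nonneg_orthant) \<inter> nonneg_orthant \<noteq> {}"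
    using assms by (simp add: FS_matrix_def)
  then obtain x where "x \<in> nonneg_orthant" "B *v x + (\<chi> i. - 1) \<in> nonneg_orthant"
    by blast
  then show ?thesis
    by (intro that[of x]) (auto simp: nonneg_orthant_def)
qed

text \<open>A nonnegative \<open>x\<close> with all coordinates of \<open>B *v x\<close> at least 1
  is nonzero, so its form value would be positive.\<close>

lemma form_nonpositive_not_FS:
  fixes B :: "real ^ 'm ^ 'm"
  assumes "form_nonpositive B"
  shows "\<not> FS_matrix B"
proof
  assume "FS_matrix B"
  then obtain x where x: "\<And>i. 0 \<le> x $ i" "\<And>i. 1 \<le> (B *v x) $ i"
    using FS_imp_positive_image by blast
  then have "x \<noteq> 0"
    by (metis matrix_vector_mult_0_right not_one_le_zero zero_index)
  then obtain k where "x $ k > 0"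
    using x(1) by (metis less_eq_real_def vec_eq_iff zero_index)
  then have "0 < (\<Sum>i\<in>UNIV. (B *v x) $ i * x $ i)"
    using x less_le_trans[OF zero_less_one x(2)] by (intro sum_pos2[of _ k]) (auto simp: less_imp_le)
  then show False
    using assms by (simp add: form_nonpositive_def inner_vec_def not_less[symmetric])
qed

lemma nonpositive_row_not_FS:
  fixes B :: "real ^ 'm ^ 'm"
  assumes "\<And>j. B $ k $ j \<le> 0"
  shows "\<not> FS_matrix B"
proof
  assume "FS_matrix B"
  then obtain x where x: "\<And>i. 0 \<le> x $ i" "\<And>i. 1 \<le> (B *v x) $ i"
    using FS_imp_positive_image by blast
  have "(B *v x) $ k \<le> 0"
    unfolding matrix_vector_mult_def
    using assms x(1) by (auto intro!: sum_nonpos mult_nonpos_nonneg)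
  with x(2)[of k] show False
    by simp
qed

lemma orbit_contains_not_FS:
  fixes A :: "real ^ 'm ^ 'm"
  assumes "y \<noteq> 0" "(A *v y) \<bullet> y \<le> 0"
  shows "\<exists>B \<in> congruence_orbit A. \<not> FS_matrix B"
proof -
  obtain k where k: "y $ k \<noteq> 0"
    using \<open>y \<noteq> 0\<close> by (metis vec_eq_iff zero_index)
  \<comment> \<open>For \<open>j \<noteq> k\<close>, entry \<open>k\<close>, \<open>j\<close> of the
    congruent matrix will be \<open>s j * ((A *v axis j 1) \<bullet> y)\<close>, which this sign
    makes nonpositive.\<close>
  define s where "s j = (if (A *v axis j 1) \<bullet> y \<le> 0 then 1 else - 1 :: real)" for j
  define L :: "real ^ 'm ^ 'm" where
    "L = (\<chi> i j. if j = k then y $ i else if i = j then s j else 0)"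
  have Lk: "L *v axis k 1 = y"
    by (simp add: matrix_vector_mult_basis column_def L_def vec_eq_iff)
  have Lj: "L *v axis j 1 = s j *\<^sub>R axis j 1" if "j \<noteq> k" for j
    using that
    unfolding matrix_vector_mult_basis by (auto simp: column_def L_def vec_eq_iff axis_def)
  have "invertible L"
    unfolding invertible_iff_ker
  proof (intro allI impI)
    fix v
    assume "L *v v = 0"
    then have v: "(\<Sum>j\<in>UNIV. L $ i $ j * v $ j) = 0" for i
      by (simp add: matrix_vector_mult_def vec_eq_iff)
    \<comment> \<open>Row \<open>k\<close> of \<open>L\<close> vanishes off the diagonal and
      \<open>y $ k \<noteq> 0\<close>, so \<open>v $ k = 0\<close>; the other rows then reduce to
      their diagonal entries \<open>s i\<close>.\<close>
    have "(\<Sum>j\<in>UNIV. L $ k $ j * v $ j) = (\<Sum>j\<in>UNIV. if j = k then y $ k * v $ k else 0)"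
      by (intro sum.cong) (auto simp: L_def)
    with v[of k] k have "v $ k = 0"
      by simp
    moreover have "v $ i = 0" if "i \<noteq> k" for i
    proof -
      have "(\<Sum>j\<in>UNIV. L $ i $ j * v $ j) = (\<Sum>j\<in>UNIV. if j = i then s i * v $ i else 0)"
        using that \<open>v $ k = 0\<close> by (intro sum.cong) (auto simp: L_def)
      with v[of i] show ?thesis
        by (simp add: s_def split: if_splits)
    qed
    ultimately show "v = 0"
      by (metis vec_eq_iff zero_index)
  qed
  moreover have "\<not> FS_matrix (transpose L ** A ** L)"
  proof (rule nonpositive_row_not_FS)
    fix j
    show "(transpose L ** A ** L) $ k $ j \<le> 0"
      unfolding matrix_entry_form congruence_form Lk
      using assms(2) by (cases "j = k") (auto simp: Lk Lj s_def matrix_vector_mult_scaleR)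
  qed
  ultimately show ?thesis
    by (auto simp: congruence_orbit_def)
qed

section \<open>Finding a Q-matrix in the orbit\<close>

lemma positive_entries_imp_Q:
  fixes B :: "real ^ 'm ^ 'm"
  assumes "\<And>i j. B $ i $ j > 0"
  shows "Q_matrix B"
proof (rule strictly_copositive_imp_Q)
  fix x :: "real ^ 'm"
  assume "x \<in> nonneg_orthant" "x \<noteq> 0"
  then have x: "0 \<le> x $ i" for i
    by (simp add: nonneg_orthant_def)
  obtain k where k: "x $ k > 0"
    using x \<open>x \<noteq> 0\<close> by (metis less_eq_real_def vec_eq_iff zero_index)
  have "0 < (\<Sum>j\<in>UNIV. B $ i $ j * x $ j)" for i
    using k x assms by (intro sum_pos2[of _ k]) (auto simp: less_imp_le)
  then have "0 < (B *v x) $ i" for i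
    by (simp add: matrix_vector_mult_def)
  then show "(B *v x) \<bullet> x > 0"
    unfolding inner_vec_def inner_real_def
    using k x by (intro sum_pos2[of _ k]) (auto simp: less_imp_le)
qed

lemma orbit_contains_Q:
  fixes A :: "real ^ 'm ^ 'm"
  assumes "(A *v x) \<bullet> x > 0"
  shows "\<exists>B \<in> congruence_orbit A. Q_matrix B"
proof -
  \<comment> \<open>The matrix \<open>L\<close> below is \<open>e\<close> times the identity plus
    the rank-one matrix with all columns \<open>x\<close>. Its determinant is a power of
    \<open>e\<close> times \<open>e + \<sigma>\<close>, so only \<open>0\<close> and
    \<open>- \<sigma>\<close> must be avoided.\<close>
  define \<sigma> where "\<sigma> = (\<Sum>i\<in>UNIV. x $ i)"
  have "\<forall>\<^sub>F e in at 0. 0 < (A *v (x + e *\<^sub>R axis j 1)) \<bullet> (x + e *\<^sub>R axis i 1)" for i j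
  proof (rule order_tendstoD(1))
    have "((\<lambda>e. (A *v (x + e *\<^sub>R axis j 1)) \<bullet> (x + e *\<^sub>R axis i 1)) \<longlongrightarrow>
        (A *v (x + 0 *\<^sub>R axis j 1)) \<bullet> (x + 0 *\<^sub>R axis i 1)) (at 0)"
      by (intro tendsto_intros bounded_linear.tendsto[OF matrix_vector_mul_bounded_linear])
    then show "((\<lambda>e. (A *v (x + e *\<^sub>R axis j 1)) \<bullet> (x + e *\<^sub>R axis i 1)) \<longlongrightarrow> (A *v x) \<bullet> x) (at 0)"
      by simp
  qed (fact assms)
  then have "\<forall>\<^sub>F e in at 0. \<forall>i j. 0 < (A *v (x + e *\<^sub>R axis j 1)) \<bullet> (x + e *\<^sub>R axis i 1)"
    by (intro eventually_all_finite)
  moreover have "\<forall>\<^sub>F e in at 0. e \<noteq> - \<sigma>"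
    by (rule eventually_neq_at_within)
  moreover have "\<forall>\<^sub>F e in at (0::real). e \<noteq> 0"
    by (simp add: eventually_neq_at_within)
  ultimately have "\<forall>\<^sub>F e in at 0. (\<forall>i j. 0 < (A *v (x + e *\<^sub>R axis j 1)) \<bullet> (x + e *\<^sub>R axis i 1)) \<and>
      e \<noteq> - \<sigma> \<and> e \<noteq> 0"
    by eventually_elim blast
  then obtain e where e: "\<And>i j. 0 < (A *v (x + e *\<^sub>R axis j 1)) \<bullet> (x + e *\<^sub>R axis i 1)"
      "e \<noteq> - \<sigma>" "e \<noteq> 0"
    using eventually_happens'[OF at_neq_bot] by blast
  define L :: "real ^ 'm ^ 'm" where "L = (\<chi> i j. x $ i + (if i = j then e else 0))"
  have Lj: "L *v axis j 1 = x + e *\<^sub>R axis j 1" for j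
    unfolding matrix_vector_mult_basis by (auto simp: column_def L_def vec_eq_iff axis_def)
  have "invertible L"
    unfolding invertible_iff_ker
  proof (intro allI impI)
    fix v
    assume "L *v v = 0"
    define t where "t = (\<Sum>j\<in>UNIV. v $ j)"
    have "(L *v v) $ i = x $ i * t + e * v $ i" for i
    proof -
      have "(L *v v) $ i = (\<Sum>j\<in>UNIV. x $ i * v $ j + (if j = i then e * v $ i else 0))"
        unfolding matrix_vector_mult_def vec_lambda_beta
        by (intro sum.cong) (auto simp: L_def algebra_simps)
      then show ?thesis
        by (simp add: sum.distrib t_def sum_distrib_left)
    qed
    with \<open>L *v v = 0\<close> have v: "x $ i * t + e * v $ i = 0" for i
      by (metis zero_index)
    \<comment> \<open>Summing the coordinates leaves one scalar equation for \<open>t\<close>; once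
      \<open>t = 0\<close>, the system reads \<open>e * v $ i = 0\<close>.\<close>
    then have "(\<Sum>i\<in>UNIV. x $ i * t + e * v $ i) = 0"
      by simp
    then have "(\<sigma> + e) * t = 0"
      by (simp add: sum.distrib \<sigma>_def t_def sum_distrib_left sum_distrib_right algebra_simps)
    with e(2) have "t = 0"
      by (simp add: add_eq_0_iff)
    with v e(3) show "v = 0"
      by (simp add: vec_eq_iff)
  qed
  moreover have "Q_matrix (transpose L ** A ** L)"
  proof (rule positive_entries_imp_Q)
    show "(transpose L ** A ** L) $ i $ j > 0" for i j
      unfolding matrix_entry_form congruence_form Lj by (rule e)
  qed
  ultimately show ?thesis
    by (auto simp: congruence_orbit_def)
qed

theorem corollary3:
  fixes A :: "real ^ 'm ^ 'm"
  assumes "invertible A"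
  shows "(form_positive A \<or> form_nonpositive A \<or> form_mixed A)
       \<and> \<not> (form_positive A \<and> form_nonpositive A)
       \<and> \<not> (form_positive A \<and> form_mixed A)
       \<and> \<not> (form_nonpositive A \<and> form_mixed A)
       \<and> (form_positive A \<longleftrightarrow> (\<forall>B \<in> congruence_orbit A. FS_matrix B))
       \<and> (form_positive A \<longleftrightarrow> (\<forall>B \<in> congruence_orbit A. Q_matrix B))
       \<and> (form_positive A \<longleftrightarrow> (\<forall>B \<in> congruence_orbit A. P_matrix B))
       \<and> (form_nonpositive A \<longrightarrow> (\<forall>B \<in> congruence_orbit A. \<not> FS_matrix B))
       \<and> (form_mixed A \<longrightarrow> (\<exists>B \<in> congruence_orbit A. \<not> FS_matrix B)
                        \<and> (\<exists>B \<in> congruence_orbit A. Q_matrix B))"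
proof -
  have tri: "form_positive A \<or> form_nonpositive A \<or> form_mixed A"
  proof (cases "form_nonpositive A \<or> form_positive A")
    case False
    then obtain x y where "(A *v x) \<bullet> x > 0" "y \<noteq> 0" "(A *v y) \<bullet> y \<le> 0"
      by (auto simp: form_nonpositive_def form_positive_def not_le not_less)
    moreover from this have "x \<noteq> 0"
      by auto
    ultimately show ?thesis
      unfolding form_mixed_def by blast
  qed blast
  \<comment> \<open>A nonzero vector must exist for positivity to contradict nonpositivity.\<close>
  have "axis undefined 1 \<noteq> (0 :: real ^ 'm)"
    by simp
  then have excl: "\<not> (form_positive A \<and> form_nonpositive A)"
      "\<not> (form_positive A \<and> form_mixed A)" "\<not> (form_nonpositive A \<and> form_mixed A)"
    unfolding form_positive_def form_nonpositive_def form_mixed_def by (meson not_le)+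
  have pos: "P_matrix B" "Q_matrix B" "FS_matrix B"
    if "form_positive A" "B \<in> congruence_orbit A" for B
    using form_positive_imp_P[OF form_positive_congruence[OF that]] P_imp_Q Q_imp_FS by auto
  have nonpos: "\<not> FS_matrix B" if "form_nonpositive A" "B \<in> congruence_orbit A" for B
    using form_nonpositive_not_FS form_nonpositive_congruence that by blast
  have mixed: "\<exists>B \<in> congruence_orbit A. \<not> FS_matrix B" "\<exists>B \<in> congruence_orbit A. Q_matrix B"
    if "form_mixed A"
    using that orbit_contains_not_FS orbit_contains_Q unfolding form_mixed_def by blast+
  \<comment> \<open>In the nonpositive case \<open>A\<close> itself is the witness. As P implies Q
    and Q implies FS, this one failure settles the converse of all three equivalences.\<close>
  have notpos: "\<exists>B \<in> congruence_orbit A. \<not> FS_matrix B" if "\<not> form_positive A"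
    using that tri nonpos mixed congruence_orbit_refl by blast
  have "form_positive A \<longleftrightarrow> (\<forall>B \<in> congruence_orbit A. FS_matrix B)"
    "form_positive A \<longleftrightarrow> (\<forall>B \<in> congruence_orbit A. Q_matrix B)"
    "form_positive A \<longleftrightarrow> (\<forall>B \<in> congruence_orbit A. P_matrix B)"
    using pos notpos Q_imp_FS P_imp_Q by blast+
  with tri excl nonpos mixed show ?thesis
    by blast
qed

end
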